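(* Let $G$ be a connected planar cubic bipartite graph and let $e_1,e_2$ be any two edges of $G$. Then there exists a 2-factor of $G$ such that $e_1$ and $e_2$ are contained in the same cycle of the 2-factor.
   Context: Graphs may have multiple edges but no self-loops. A 2-factor is a spanning 2-regular subgraph, i.e., a disjoint union of cycles covering all vertices. *)

theory Defs
  imports "HOL-Analysis.Analysis"
begin

text \<open>
  Undirected multigraphs: edges have their own identity, so parallel edges are allowed,
  and the two-element end sets exclude self-loops.
\<close>

record ('v, 'e) mgraph =
  mverts :: "'v set"
  medges :: "'e set"
  mends :: "'e \<Rightarrow> 'v set"

definition multigraph :: "('v, 'e) mgraph \<Rightarrow> bool" where
  "multigraph G \<longleftrightarrow> finite (mverts G) \<and> finite (medges G) \<and>
     (\<forall>e\<in>medges G. mends G e \<subseteq> mverts G \<and> card (mends G e) = 2)"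

definition mdegree :: "('v, 'e) mgraph \<Rightarrow> 'v \<Rightarrow> nat" where
  "mdegree G v = card {e \<in> medges G. v \<in> mends G e}"

definition mregular :: "nat \<Rightarrow> ('v, 'e) mgraph \<Rightarrow> bool" where
  "mregular k G \<longleftrightarrow> (\<forall>v\<in>mverts G. mdegree G v = k)"

abbreviation mcubic :: "('v, 'e) mgraph \<Rightarrow> bool" where
  "mcubic \<equiv> mregular 3"

definition madjacent :: "('v, 'e) mgraph \<Rightarrow> ('v \<times> 'v) set" where
  "madjacent G = {(u, v). \<exists>e\<in>medges G. mends G e = {u, v}}"

definition mconnected :: "('v, 'e) mgraph \<Rightarrow> bool" where
  "mconnected G \<longleftrightarrow> mverts G \<noteq> {} \<and>
     (\<forall>u\<in>mverts G. \<forall>v\<in>mverts G. (u, v) \<in> (madjacent G)\<^sup>*)"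

definition mbipartite :: "('v, 'e) mgraph \<Rightarrow> bool" where
  "mbipartite G \<longleftrightarrow> (\<exists>A B. A \<union> B = mverts G \<and> A \<inter> B = {} \<and>
     (\<forall>e\<in>medges G. \<exists>a\<in>A. \<exists>b\<in>B. mends G e = {a, b}))"

text \<open>
  A drawing without crossings in the plane (identified with the complex numbers): vertices are
  distinct points, edges are simple arcs joining the points of their ends, an arc passes through
  no other vertex point, and distinct arcs meet only in vertex points.
\<close>

definition plane_drawing ::
  "('v, 'e) mgraph \<Rightarrow> ('v \<Rightarrow> complex) \<Rightarrow> ('e \<Rightarrow> real \<Rightarrow> complex) \<Rightarrow> bool" where
  "plane_drawing G p \<gamma> \<longleftrightarrow>
     inj_on p (mverts G) \<and>
     (\<forall>e\<in>medges G. arc (\<gamma> e) \<and>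
        {pathstart (\<gamma> e), pathfinish (\<gamma> e)} = p ` mends G e \<and>
        path_image (\<gamma> e) \<inter> p ` mverts G = p ` mends G e) \<and>
     (\<forall>e\<in>medges G. \<forall>f\<in>medges G. e \<noteq> f \<longrightarrow>
        path_image (\<gamma> e) \<inter> path_image (\<gamma> f) \<subseteq> p ` mverts G)"

definition mplanar :: "('v, 'e) mgraph \<Rightarrow> bool" where
  "mplanar G \<longleftrightarrow> (\<exists>p \<gamma>. plane_drawing G p \<gamma>)"

definition msubgraph :: "('v, 'e) mgraph \<Rightarrow> ('v, 'e) mgraph \<Rightarrow> bool" where
  "msubgraph H G \<longleftrightarrow> multigraph H \<and> mverts H \<subseteq> mverts G \<and> medges H \<subseteq> medges G \<and>
     (\<forall>e\<in>medges H. mends H e = mends G e)"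

definition two_factor :: "('v, 'e) mgraph \<Rightarrow> ('v, 'e) mgraph \<Rightarrow> bool" where
  "two_factor F G \<longleftrightarrow> msubgraph F G \<and> mverts F = mverts G \<and> mregular 2 F"

text \<open>
  The shortest cycles are pairs of parallel edges. A cycle that is a subgraph of a 2-regular
  graph is necessarily one of its connected components.
\<close>

definition mcycle :: "('v, 'e) mgraph \<Rightarrow> bool" where
  "mcycle C \<longleftrightarrow> (\<exists>vs es. length vs \<ge> 2 \<and> length es = length vs \<and>
     distinct vs \<and> distinct es \<and> mverts C = set vs \<and> medges C = set es \<and>
     (\<forall>i<length vs. mends C (es ! i) = {vs ! i, vs ! (Suc i mod length vs)}))"

end

theory Submission
  imports Defs
begin

text \<open>
  Let \<open>e1 = a1 b1\<close> and \<open>e2 = a2 b2\<close> with \<open>a1, a2\<close> in one colour class. If the edges share an end,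
  delete a perfect matching through the third edge there. Otherwise Hall's theorem yields a perfect
  matching \<open>M\<close> of \<open>G - a1 - b2\<close>, since in a connected cubic bipartite graph every nonempty
  proper subset of a colour class has more neighbours than elements. A second application of Hall's
  theorem, to \<open>G - M - e1 - e2\<close>, where all degrees are 2 except for \<open>a2\<close> and \<open>b1\<close> of degree 1,
  yields a perfect matching \<open>N\<close> of \<open>G\<close>. In the 2-factor \<open>G - N\<close>, which contains \<open>M\<close>, \<open>e1\<close> and \<open>e2\<close>,
  a cycle through \<open>e1\<close> that avoids \<open>e2\<close> would have its two equally large colour classes matched
  by \<open>M\<close> up to the single uncovered vertex \<open>a1\<close>, which is absurd.
\<close>

section \<open>Hall's theorem for multigraphs\<close>

text \<open>A bipartite multigraph is given by its edge set \<open>E\<close> and the two maps \<open>s\<close> and \<open>t\<close> sending an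
  edge to its ends in the two colour classes.\<close>

lemma hall_matching:
  fixes s :: "'e \<Rightarrow> 'a" and t :: "'e \<Rightarrow> 'b"
  assumes "finite A" "finite E"
    and "\<And>S. S \<subseteq> A \<Longrightarrow> card S \<le> card (t ` {e\<in>E. s e \<in> S})"
  shows "\<exists>M\<subseteq>E. bij_betw s M A \<and> inj_on t M"
  using assms
proof (induction "card A" arbitrary: A E rule: less_induct)
  case less
  note finA = less.prems(1) and finE = less.prems(2) and hall = less.prems(3)
  show ?case
  proof (cases "A = {}")
    case True
    then show ?thesis by (intro exI[of _ "{}"]) (auto simp: bij_betw_def)
  next
    case nonempty: False
    \<comment> \<open>Induction in the style of Halmos and Vaughan. If some nonempty proper subset
      \<open>S\<close> is tight, \<open>S\<close> and \<open>A - S\<close> are matched separately;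
      otherwise each such subset has a surplus neighbour, and an arbitrary edge can be matched
      first.\<close>
    show ?thesis
    proof (cases "\<exists>S. S \<subset> A \<and> S \<noteq> {} \<and> card (t ` {e\<in>E. s e \<in> S}) \<le> card S")
      case True
      then obtain S where S: "S \<subset> A" "S \<noteq> {}" "card (t ` {e\<in>E. s e \<in> S}) \<le> card S"
        by blast
      have finS: "finite S" using S(1) finA finite_subset by blast
      let ?T = "t ` {e\<in>E. s e \<in> S}"
      have "card S < card A" using S(1) finA by (simp add: psubset_card_mono)
      then obtain M1 where M1: "M1 \<subseteq> E" "bij_betw s M1 S" "inj_on t M1"
        using less.hyps[of S E] finS finE hall S(1) by (metis dual_order.trans psubset_imp_subset)
      define E' where "E' = {e\<in>E. t e \<notin> ?T}"
      \<comment> \<open>Hall's condition survives for \<open>A - S\<close>: the set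
        \<open>U \<union> S\<close> has enough neighbours in \<open>E\<close>, and by tightness at
        most \<open>card S\<close> of them lie in \<open>?T\<close>.\<close>
      have "card U \<le> card (t ` {e\<in>E'. s e \<in> U})" if U: "U \<subseteq> A - S" for U
      proof -
        have finU: "finite U" using U finA finite_subset by blast
        have "card U + card S = card (U \<union> S)"
          using U finU finS by (subst card_Un_disjoint) auto
        also have "\<dots> \<le> card (t ` {e\<in>E. s e \<in> U \<union> S})"
          using U S by (intro hall) auto
        also have "t ` {e\<in>E. s e \<in> U \<union> S} = t ` {e\<in>E'. s e \<in> U} \<union> ?T"
          unfolding E'_def by blast
        also have "card \<dots> \<le> card (t ` {e\<in>E'. s e \<in> U}) + card ?T" by (rule card_Un_le)
        finally show ?thesis using S(3) by linarith
      qed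
      moreover have "card (A - S) < card A" using S(1,2) finA by (intro psubset_card_mono) auto
      moreover have "finite E'" using finE unfolding E'_def by simp
      ultimately obtain M2 where M2: "M2 \<subseteq> E'" "bij_betw s M2 (A - S)" "inj_on t M2"
        using less.hyps[of "A - S" E'] finA by blast
      have "t ` M1 \<subseteq> ?T" using M1(1) bij_betwE[OF M1(2)] by blast
      moreover have "t ` M2 \<inter> ?T = {}" using M2(1) unfolding E'_def by blast
      ultimately have "inj_on t (M1 \<union> M2)" using M1(3) M2(3) by (auto simp: inj_on_Un)
      moreover have "bij_betw s (M1 \<union> M2) (S \<union> (A - S))"
        using M1(2) M2(2) by (intro bij_betw_combine) auto
      moreover have "S \<union> (A - S) = A" using S(1) by blast
      moreover have "M1 \<union> M2 \<subseteq> E" using M1(1) M2(1) unfolding E'_def by blast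
      ultimately show ?thesis by metis
    next
      case False
      obtain a where a: "a \<in> A" using nonempty by blast
      have "1 \<le> card (t ` {e\<in>E. s e \<in> {a}})" using hall[of "{a}"] a by simp
      then have "t ` {e\<in>E. s e \<in> {a}} \<noteq> {}" by (metis card.empty not_one_le_zero)
      then obtain d where d: "d \<in> E" "s d = a" by blast
      define E' where "E' = {e\<in>E. t e \<noteq> t d}"
      \<comment> \<open>Discarding the vertex \<open>t d\<close> costs \<open>U\<close> at most one
        neighbour, and the surplus of every nonempty proper subset pays for it.\<close>
      have "card U \<le> card (t ` {e\<in>E'. s e \<in> U})" if U: "U \<subseteq> A - {a}" for U
      proof (cases "U = {}")
        case U': False
        have "U \<subset> A" using U a by blast
        then have "card U < card (t ` {e\<in>E. s e \<in> U})"
          using False U' by (meson not_le)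
        moreover have "t ` {e\<in>E'. s e \<in> U} = t ` {e\<in>E. s e \<in> U} - {t d}"
          unfolding E'_def by auto
        ultimately show ?thesis using card_Diff_singleton_if[of "t ` {e\<in>E. s e \<in> U}" "t d"]
          by (auto split: if_splits)
      qed simp
      moreover have "card (A - {a}) < card A" using a finA by (intro card_Diff1_less)
      moreover have "finite E'" using finE unfolding E'_def by simp
      ultimately obtain M where M: "M \<subseteq> E'" "bij_betw s M (A - {a})" "inj_on t M"
        using less.hyps[of "A - {a}" E'] finA by blast
      have "bij_betw s (M \<union> {d}) ((A - {a}) \<union> {a})"
        using M(2) d by (intro bij_betw_combine) (auto simp: bij_betw_def)
      moreover have "(A - {a}) \<union> {a} = A" using a by blast
      moreover have "inj_on t (M \<union> {d})" using M(1,3) unfolding E'_def by (auto simp: inj_on_Un)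
      moreover have "M \<union> {d} \<subseteq> E" using M(1) d unfolding E'_def by blast
      ultimately show ?thesis by metis
    qed
  qed
qed

lemma card_edges_eq_sum_degrees:
  assumes "finite E" "finite S"
  shows "card {e\<in>E. s e \<in> S} = (\<Sum>a\<in>S. card {e\<in>E. s e = a})"
proof -
  have "{e\<in>E. s e \<in> S} = (\<Union>a\<in>S. {e\<in>E. s e = a})" by auto
  then show ?thesis using assms by (simp, subst card_UN_disjoint) auto
qed

section \<open>Cycles in 2-regular multigraphs\<close>

text \<open>Take a longest path through \<open>e\<close>. The second edge at its last vertex cannot
  leave the path, by maximality, nor return to an inner vertex, whose degree is exhausted; so it
  closes a cycle. The two cycle edges at each vertex use up its degree, which makes the cycle a
  whole component.\<close>

lemma two_regular_cycle:
  assumes F: "multigraph F" "mregular 2 F" and e: "e \<in> medges F"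
  obtains C where "mcycle C" "msubgraph C F" "e \<in> medges C"
    "\<And>d. d \<in> medges F \<Longrightarrow> mends F d \<inter> mverts C \<noteq> {} \<Longrightarrow> d \<in> medges C"
proof -
  \<comment> \<open>Only paths containing \<open>e\<close> compete, so the cycle obtained from a
    longest one contains \<open>e\<close>.\<close>
  define path where "path vs es \<longleftrightarrow> length vs = Suc (length es) \<and> distinct vs \<and> set vs \<subseteq> mverts F \<and>
    set es \<subseteq> medges F \<and> e \<in> set es \<and> (\<forall>i<length es. mends F (es ! i) = {vs ! i, vs ! Suc i})"
    for vs es
  have ends: "mends F d \<subseteq> mverts F" "card (mends F d) = 2" if "d \<in> medges F" for d
    using F(1) that by (auto simp: multigraph_def)
  have deg: "card {d \<in> medges F. v \<in> mends F d} = 2" if "v \<in> mverts F" for v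
    using F(2) that by (simp add: mregular_def mdegree_def)
  have fin: "finite (mverts F)" "finite (medges F)" using F(1) by (auto simp: multigraph_def)
  obtain x y where xy: "mends F e = {x, y}" "x \<noteq> y" using ends(2)[OF e] by (auto simp: card_2_iff)
  have single: "\<exists>es. path [x, y] es" using xy e ends(1)[OF e] by (intro exI[of _ "[e]"]) (auto simp: path_def)
  have bound: "length vs \<le> card (mverts F)" if "path vs es" for vs es
  proof -
    have "length vs = card (set vs)" using that by (simp add: path_def distinct_card)
    also have "\<dots> \<le> card (mverts F)" using that fin by (intro card_mono) (simp_all add: path_def)
    finally show ?thesis .
  qed
  obtain vs where vs: "\<exists>es. path vs es"
    and max: "\<And>vs'. \<exists>es'. path vs' es' \<Longrightarrow> length vs' \<le> length vs"
    using ex_has_greatest_nat[of "\<lambda>vs. \<exists>es. path vs es" "[x, y]" length "Suc (card (mverts F))"]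
      single bound by (metis le_imp_less_Suc)
  then obtain es where es: "path vs es" by blast
  define m where "m = length es"
  have len: "length vs = Suc m" "length es = m" and dist: "distinct vs"
    and sub: "set vs \<subseteq> mverts F" "set es \<subseteq> medges F" and e_es: "e \<in> set es"
    and step: "\<And>i. i < m \<Longrightarrow> mends F (es ! i) = {vs ! i, vs ! Suc i}"
    using es by (auto simp: path_def m_def)
  have m: "0 < m" using e_es len by (cases es) auto
  have idx: "vs ! i = vs ! j \<longleftrightarrow> i = j" if "i \<le> m" "j \<le> m" for i j
    using dist that len by (simp add: nth_eq_iff_index_eq)
  have es_in: "es ! i \<in> medges F" if "i < m" for i using that sub len by auto
  have es_inj: "i = j" if "es ! i = es ! j" "i < m" "j < m" for i j
  proof -
    have "{vs ! i, vs ! Suc i} = {vs ! j, vs ! Suc j}" using that step by metis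
    then show ?thesis using that idx[of i j] idx[of i "Suc j"] idx[of "Suc i" j]
      by (auto simp: doubleton_eq_iff)
  qed
  let ?v = "vs ! m"
  have "?v \<in> mverts F" using sub len by auto
  moreover have "es ! (m - 1) \<in> {d \<in> medges F. ?v \<in> mends F d}"
    using m step[of "m - 1"] es_in[of "m - 1"] by auto
  ultimately obtain g where g: "g \<in> medges F" "?v \<in> mends F g" "g \<noteq> es ! (m - 1)"
    using deg[of ?v] by (auto simp: card_2_iff doubleton_eq_iff set_eq_iff)
  have "card (mends F g - {?v}) = 1" using ends(2)[OF g(1)] g(2) by simp
  then obtain w where "mends F g - {?v} = {w}" by (auto simp: card_1_singleton_iff)
  then have w: "mends F g = {?v, w}" "w \<noteq> ?v" using g(2) by auto
  \<comment> \<open>Only the last edge of the path meets \<open>?v\<close>, so \<open>g\<close> is a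
    new edge, even if it is parallel to that one. This keeps cycles of length two valid.\<close>
  have g_new: "g \<noteq> es ! i" if "i < m" for i
  proof
    assume "g = es ! i"
    then have "?v \<in> {vs ! i, vs ! Suc i}" using g(2) step[OF that] by simp
    then have "i = m - 1" using idx[of m i] idx[of m "Suc i"] that by auto
    then show False using g(3) \<open>g = es ! i\<close> by simp
  qed
  have "w \<in> set vs"
  proof (rule ccontr)
    assume "w \<notin> set vs"
    then have "path (vs @ [w]) (es @ [g])"
      using len dist sub e_es g w ends(1)[OF g(1)] step
      by (auto simp: path_def nth_append less_Suc_eq)
    then show False using max[of "vs @ [w]"] by auto
  qed
  then obtain k where k: "k \<le> m" "w = vs ! k" using len by (auto simp: in_set_conv_nth less_Suc_eq_le)
  \<comment> \<open>Absence of loops excludes \<open>k = m\<close>. For \<open>0 < k < m\<close> the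
    vertex \<open>w\<close> would meet the two path edges around it and also \<open>g\<close>, three
    edges in all.\<close>
  have "k = 0"
  proof (rule ccontr)
    assume "k \<noteq> 0"
    moreover have "k \<noteq> m" using w k by auto
    ultimately have k': "0 < k" "k < m" using k by auto
    have "{es ! (k - 1), es ! k, g} \<subseteq> {d \<in> medges F. w \<in> mends F d}"
      using k k' step[of "k - 1"] step[of k] es_in g w by auto
    moreover have "k - 1 < m" "k - 1 \<noteq> k" using k' by linarith+
    then have "es ! (k - 1) \<noteq> es ! k" "g \<noteq> es ! k" "g \<noteq> es ! (k - 1)"
      using k' es_inj[of "k - 1" k] g_new[of k] g_new[of "k - 1"] by blast+
    then have "card {es ! (k - 1), es ! k, g} = 3" by auto
    moreover have "w \<in> mverts F" using ends(1)[OF g(1)] w by auto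
    ultimately show False
      using deg[of w] fin card_mono[of "{d \<in> medges F. w \<in> mends F d}" "{es ! (k - 1), es ! k, g}"]
      by simp
  qed
  define ds where "ds = es @ [g]"
  have len_ds: "length ds = Suc m" by (simp add: ds_def len)
  have "distinct es" using len es_inj by (auto simp: distinct_conv_nth)
  moreover have "g \<notin> set es" using len g_new by (auto simp: in_set_conv_nth)
  ultimately have dist_ds: "distinct ds" by (simp add: ds_def)
  have step_ds: "mends F (ds ! i) = {vs ! i, vs ! (Suc i mod Suc m)}" if "i < Suc m" for i
    using that step w k \<open>k = 0\<close> len by (cases "i = m") (auto simp: ds_def nth_append)
  define C where "C = \<lparr>mverts = set vs, medges = set ds, mends = mends F\<rparr>"
  have ds_sub: "set ds \<subseteq> medges F" using sub g by (auto simp: ds_def)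
  have vs_in: "vs ! j \<in> set vs" if "j < Suc m" for j using that len by simp
  have ends_C: "mends F d \<subseteq> set vs" if d: "d \<in> set ds" for d
  proof -
    obtain i where "i < Suc m" "d = ds ! i" using d len_ds by (auto simp: in_set_conv_nth)
    then show ?thesis using step_ds[of i] vs_in[of i] vs_in[of "Suc i mod Suc m"] by auto
  qed
  show ?thesis
  proof (rule that[of C])
    show "mcycle C"
      unfolding mcycle_def using len m dist dist_ds len_ds step_ds
      by (intro exI[of _ vs] exI[of _ ds]) (auto simp: C_def)
    show "msubgraph C F"
      using sub ds_sub ends(2) ends_C unfolding msubgraph_def multigraph_def C_def by simp blast
    show "e \<in> medges C" using e_es by (simp add: C_def ds_def)
  next
    fix d assume d: "d \<in> medges F" "mends F d \<inter> mverts C \<noteq> {}"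
    then obtain v where v: "v \<in> mends F d" "v \<in> set vs" by (auto simp: C_def)
    obtain i where i: "i < Suc m" "v = vs ! i" using v(2) len by (auto simp: in_set_conv_nth)
    \<comment> \<open>The index \<open>j\<close> is the cyclic predecessor of \<open>i\<close>, so
      \<open>ds ! j\<close> and \<open>ds ! i\<close> are the two cycle edges at
      \<open>v\<close>.\<close>
    define j where "j = (if i = 0 then m else i - 1)"
    have j: "j < Suc m" "Suc j mod Suc m = i" "j \<noteq> i" using i m by (auto simp: j_def)
    have "{ds ! i, ds ! j} \<subseteq> {d \<in> medges F. v \<in> mends F d}"
      using step_ds[of i] step_ds[of j] i j ds_sub len_ds by (auto simp: subset_iff)
    moreover have "card {ds ! i, ds ! j} = 2"
      using dist_ds i j len_ds by (auto simp: nth_eq_iff_index_eq)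
    moreover have "card {d \<in> medges F. v \<in> mends F d} = 2" using deg v sub by blast
    ultimately have "{ds ! i, ds ! j} = {d \<in> medges F. v \<in> mends F d}"
      using fin by (intro card_subset_eq) auto
    then have "d \<in> {ds ! i, ds ! j}" using d v by blast
    then show "d \<in> medges C" using i j len_ds by (auto simp: C_def)
  qed
qed

section \<open>Connected cubic bipartite multigraphs\<close>

text \<open>Connectedness is stated without walks: if no edge joins \<open>S \<union> T\<close> to
  the rest, this set is a union of components, so it is everything once \<open>S\<close> is
  nonempty.\<close>

locale cubic_bipartite =
  fixes E :: "'e set" and s t :: "'e \<Rightarrow> 'v" and A B :: "'v set"
  assumes fin: "finite E" "finite A" "finite B"
    and ends: "e \<in> E \<Longrightarrow> s e \<in> A" "e \<in> E \<Longrightarrow> t e \<in> B"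
    and deg_A: "a \<in> A \<Longrightarrow> card {e\<in>E. s e = a} = 3"
    and deg_B: "b \<in> B \<Longrightarrow> card {e\<in>E. t e = b} = 3"
    and connected: "\<lbrakk>S \<subseteq> A; T \<subseteq> B; S \<noteq> {}; \<And>e. e \<in> E \<Longrightarrow> s e \<in> S \<longleftrightarrow> t e \<in> T\<rbrakk> \<Longrightarrow> S = A"
begin

lemma card_A_eq_card_B: "card A = card B"
proof -
  have "{e\<in>E. s e \<in> A} = {e\<in>E. t e \<in> B}" using ends by auto
  then have "(\<Sum>a\<in>A. card {e\<in>E. s e = a}) = (\<Sum>b\<in>B. card {e\<in>E. t e = b})"
    using card_edges_eq_sum_degrees[of E A s] card_edges_eq_sum_degrees[of E B t] fin by simp
  then show ?thesis by (simp add: deg_A deg_B)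
qed

text \<open>The \<open>3 * card S\<close> edges at \<open>S\<close> all end in its neighbourhood
  \<open>?T\<close>, which meets \<open>3 * card ?T\<close> edges. Without a surplus these edge sets
  coincide, so \<open>S\<close> and \<open>?T\<close> are closed under all edges, against
  connectedness.\<close>

lemma card_neighbours_gt:
  assumes S: "S \<subset> A" "S \<noteq> {}"
  shows "card S < card (t ` {e\<in>E. s e \<in> S})"
proof (rule ccontr)
  let ?T = "t ` {e\<in>E. s e \<in> S}"
  assume "\<not> card S < card ?T"
  then have le: "card ?T \<le> card S" by simp
  have T: "?T \<subseteq> B" using ends by auto
  have finST: "finite S" "finite ?T" using S T fin by (auto intro: finite_subset)
  have "card {e\<in>E. s e \<in> S} = 3 * card S"
    using deg_A S(1) by (subst card_edges_eq_sum_degrees) (auto simp: fin finST subset_iff)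
  moreover have "card {e\<in>E. t e \<in> ?T} = 3 * card ?T"
    using deg_B T by (subst card_edges_eq_sum_degrees[OF fin(1) finST(2)]) (simp add: subset_iff)
  moreover have "{e\<in>E. s e \<in> S} \<subseteq> {e\<in>E. t e \<in> ?T}" by auto
  ultimately have "{e\<in>E. s e \<in> S} = {e\<in>E. t e \<in> ?T}"
    using le fin by (intro card_seteq) auto
  then have "S = A" using S T by (intro connected[of S ?T]) auto
  then show False using S by blast
qed

text \<open>The surplus neighbour of each nonempty proper subset absorbs the loss of
  \<open>b\<close>, so Hall's theorem applies to \<open>A - {a}\<close>. Since both colour classes
  have the same size, the matching covers all of \<open>B - {b}\<close>.\<close>

lemma matching_minus_two_vertices:
  assumes a: "a \<in> A" and b: "b \<in> B"
  obtains M where "M \<subseteq> E" "bij_betw s M (A - {a})" "bij_betw t M (B - {b})"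
proof -
  define E' where "E' = {e\<in>E. t e \<noteq> b}"
  have "card S \<le> card (t ` {e\<in>E'. s e \<in> S})" if S: "S \<subseteq> A - {a}" for S
  proof (cases "S = {}")
    case False
    have "card S < card (t ` {e\<in>E. s e \<in> S})" using S False a by (intro card_neighbours_gt) auto
    moreover have "t ` {e\<in>E'. s e \<in> S} = t ` {e\<in>E. s e \<in> S} - {b}" unfolding E'_def by auto
    ultimately show ?thesis using card_Diff_singleton_if[of "t ` {e\<in>E. s e \<in> S}" b]
      by (auto split: if_splits)
  qed simp
  then obtain M where M: "M \<subseteq> E'" "bij_betw s M (A - {a})" "inj_on t M"
    using hall_matching[of "A - {a}" E' t s] fin by (auto simp: E'_def)
  have "t ` M \<subseteq> B - {b}" using M(1) ends by (auto simp: E'_def)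
  moreover have "card (t ` M) = card (B - {b})"
    using M bij_betw_same_card[OF M(2)] a b fin card_A_eq_card_B by (simp add: card_image)
  ultimately have "t ` M = B - {b}" using fin by (intro card_subset_eq) auto
  then show ?thesis using M that[of M] by (auto simp: E'_def bij_betw_def)
qed

text \<open>Match everything except the two ends of \<open>d\<close>, then add
  \<open>d\<close>.\<close>

lemma perfect_matching_through:
  assumes "d \<in> E"
  obtains N where "N \<subseteq> E" "d \<in> N" "bij_betw s N A" "bij_betw t N B"
proof -
  obtain M where M: "M \<subseteq> E" "bij_betw s M (A - {s d})" "bij_betw t M (B - {t d})"
    using matching_minus_two_vertices[of "s d" "t d"] ends[OF assms] by blast
  have "bij_betw s (M \<union> {d}) ((A - {s d}) \<union> {s d})" "bij_betw t (M \<union> {d}) ((B - {t d}) \<union> {t d})"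
    using M by (auto intro!: bij_betw_combine simp: bij_betw_def)
  moreover have "(A - {s d}) \<union> {s d} = A" "(B - {t d}) \<union> {t d} = B" using ends[OF assms] by auto
  ultimately show ?thesis using M that[of "M \<union> {d}"] assms by auto
qed

text \<open>The crossed choice of uncovered vertices, one end of \<open>e1\<close> and the opposite
  end of \<open>e2\<close>, keeps the degrees in \<open>K\<close> balanced: at least 2 on the
  \<open>A\<close> side except for a deficit of one at \<open>s e2\<close>, and at most 2 on the
  \<open>B\<close> side. Double counting then gives Hall's condition for \<open>K\<close>.\<close>

lemma disjoint_matchings:
  assumes e: "e1 \<in> E" "e2 \<in> E" and ne: "s e1 \<noteq> s e2" "t e1 \<noteq> t e2"
  obtains M N where "M \<subseteq> E" "bij_betw s M (A - {s e1})" "bij_betw t M (B - {t e2})"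
    "N \<subseteq> E - M - {e1, e2}" "bij_betw s N A" "bij_betw t N B"
proof -
  obtain M where M: "M \<subseteq> E" "bij_betw s M (A - {s e1})" "bij_betw t M (B - {t e2})"
    using matching_minus_two_vertices[of "s e1" "t e2"] ends e by metis
  define K where "K = E - M - {e1, e2}"
  have finK: "finite K" using fin by (simp add: K_def)
  \<comment> \<open>\<open>M\<close> misses the vertices \<open>s e1\<close> and
    \<open>t e2\<close>, hence both edges.\<close>
  have e_M: "e1 \<notin> M" "e2 \<notin> M" using M by (auto simp: bij_betw_def)
  have deg_K_A: "2 \<le> card {e\<in>K. s e = a} + (if a = s e2 then 1 else 0)" if "a \<in> A" for a
  proof (cases "a = s e1")
    case True
    have "{e\<in>K. s e = a} = {e\<in>E. s e = a} - {e1}"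
      using True M ne by (auto simp: K_def bij_betw_def)
    then show ?thesis using True e fin deg_A[OF that] by simp
  next
    case False
    then have "a \<in> s ` M" using M(2) that by (simp add: bij_betw_def)
    then obtain d where d: "d \<in> M" "s d = a" by blast
    have in_M: "e = d" if "e \<in> M" "s e = a" for e
      using that d M(2) by (metis bij_betw_def inj_onD)
    show ?thesis
    proof (cases "a = s e2")
      case True
      have "{e\<in>K. s e = a} = {e\<in>E. s e = a} - {d, e2}"
        using in_M d(1) False True unfolding K_def by blast
      \<comment> \<open>At \<open>s e2\<close> both the \<open>M\<close>-edge \<open>d\<close> and
        \<open>e2\<close> are removed; they differ because \<open>e2\<close> is not in
        \<open>M\<close>.\<close>
      moreover have "card ({e\<in>E. s e = a} - {d, e2}) = 3 - 2"
        using True d M(1) e(2) e_M(2) deg_A[OF that] by (subst card_Diff_subset) (auto simp: card_insert_if)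
      ultimately show ?thesis using True by simp
    next
      case not_e2: False
      have "{e\<in>K. s e = a} = {e\<in>E. s e = a} - {d}"
        using in_M d(1) False not_e2 unfolding K_def by blast
      then show ?thesis using not_e2 d subsetD[OF M(1) d(1)] deg_A[OF that] by simp
    qed
  qed
  have deg_K_B: "card {e\<in>K. t e = b} \<le> 2" if b: "b \<in> B" for b
  proof -
    \<comment> \<open>Each vertex of \<open>B\<close> loses an edge: \<open>e2\<close> at the vertex
      missed by \<open>M\<close>, the \<open>M\<close>-edge elsewhere.\<close>
    obtain d where d: "d \<in> E - K" "t d = b"
    proof (cases "b = t e2")
      case True
      then show thesis using that[of e2] e by (simp add: K_def)
    next
      case False
      then have "b \<in> t ` M" using M(3) b by (simp add: bij_betw_def)
      then show thesis using that M(1) by (auto simp: K_def)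
    qed
    then have "{e\<in>K. t e = b} \<subseteq> {e\<in>E. t e = b} - {d}" by (auto simp: K_def)
    then have "card {e\<in>K. t e = b} \<le> card ({e\<in>E. t e = b} - {d})" using fin by (intro card_mono) auto
    also have "\<dots> = 2" using d fin deg_B[OF b] by simp
    finally show ?thesis .
  qed
  have "card S \<le> card (t ` {e\<in>K. s e \<in> S})" if S: "S \<subseteq> A" for S
  proof -
    let ?T = "t ` {e\<in>K. s e \<in> S}"
    have finST: "finite S" "finite ?T" using S fin finK finite_subset by auto
    have T: "?T \<subseteq> B" using ends by (auto simp: K_def)
    have "2 * card S = (\<Sum>a\<in>S. 2)" by simp
    also have "\<dots> \<le> (\<Sum>a\<in>S. card {e\<in>K. s e = a} + (if a = s e2 then 1 else 0))"
      using S by (intro sum_mono deg_K_A) auto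
    also have "\<dots> \<le> card {e\<in>K. s e \<in> S} + 1"
      using finST finK by (simp add: sum.distrib card_edges_eq_sum_degrees sum.delta)
    finally have "2 * card S \<le> card {e\<in>K. s e \<in> S} + 1" .
    also have "card {e\<in>K. s e \<in> S} \<le> card {e\<in>K. t e \<in> ?T}" using finK by (intro card_mono) auto
    also have "\<dots> = (\<Sum>b\<in>?T. card {e\<in>K. t e = b})"
      using card_edges_eq_sum_degrees finK finST by blast
    also have "\<dots> \<le> (\<Sum>b\<in>?T. 2)" using T deg_K_B by (intro sum_mono) auto
    \<comment> \<open>The count yields \<open>2 * card S \<le> 2 * card ?T + 1\<close>; by parity
      the deficit of one does no harm.\<close>
    finally show ?thesis by simp
  qed
  then obtain N where N: "N \<subseteq> K" "bij_betw s N A" "inj_on t N"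
    using hall_matching[of A K t s] fin finK by blast
  have "t ` N \<subseteq> B" using N(1) ends by (auto simp: K_def)
  moreover have "card (t ` N) = card B"
    using N bij_betw_same_card[OF N(2)] card_A_eq_card_B by (simp add: card_image)
  ultimately have "bij_betw t N B" using N fin by (simp add: bij_betw_def card_subset_eq)
  then show ?thesis using M N that[of M N] by (auto simp: K_def)
qed

text \<open>\<open>V\<close> stands for a union of components of the 2-regular graph
  \<open>H\<close>. Counting edges shows that \<open>V\<close> contains equally many vertices of
  each colour. If \<open>V\<close> avoids \<open>e2\<close>, then \<open>M\<close> matches all of
  \<open>B \<inter> V\<close> with \<open>A \<inter> V\<close> minus the uncovered vertex
  \<open>s e1\<close>, a contradiction.\<close>

lemma closed_component_contains:
  assumes M: "M \<subseteq> H" "bij_betw s M (A - {s e1})" "bij_betw t M (B - {t e2})"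
    and H: "H \<subseteq> E" "e1 \<in> H" "e2 \<in> H"
    and deg: "\<And>a. a \<in> A \<Longrightarrow> card {e\<in>H. s e = a} = 2" "\<And>b. b \<in> B \<Longrightarrow> card {e\<in>H. t e = b} = 2"
    and V: "\<And>e. e \<in> H \<Longrightarrow> s e \<in> V \<longleftrightarrow> t e \<in> V" and e1: "s e1 \<in> V"
  shows "s e2 \<in> V"
proof (rule ccontr)
  assume "s e2 \<notin> V"
  then have e2: "t e2 \<notin> V" using V H by blast
  have finH: "finite H" using H fin finite_subset by blast
  have "{e\<in>H. s e \<in> A \<inter> V} = {e\<in>H. t e \<in> B \<inter> V}" using H ends V by auto
  then have "(\<Sum>a\<in>A \<inter> V. card {e\<in>H. s e = a}) = (\<Sum>b\<in>B \<inter> V. card {e\<in>H. t e = b})"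
    using card_edges_eq_sum_degrees[of H "A \<inter> V" s] card_edges_eq_sum_degrees[of H "B \<inter> V" t] fin finH
    by simp
  then have eq: "card (A \<inter> V) = card (B \<inter> V)" by (simp add: deg)
  define L where "L = {e\<in>M. s e \<in> V}"
  \<comment> \<open>Closure of \<open>V\<close> lets the same edges be selected by either end, so
    \<open>card L\<close> can be computed on both sides.\<close>
  have L: "L = {e\<in>M. t e \<in> V}" using M(1) V by (auto simp: L_def)
  have "s ` L = s ` M \<inter> V" unfolding L_def by auto
  also have "\<dots> = A \<inter> V - {s e1}" using M(2) by (auto simp: bij_betw_def)
  finally have "card L = card (A \<inter> V - {s e1})"
    using M(2) card_image[of s L] inj_on_subset[of s M L] by (auto simp: bij_betw_def L_def)
  moreover have "t ` L = t ` M \<inter> V" unfolding L by auto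
  then have "t ` L = B \<inter> V" using M(3) e2 by (auto simp: bij_betw_def)
  then have "card L = card (B \<inter> V)"
    using M(3) card_image[of t L] inj_on_subset[of t M L] by (auto simp: bij_betw_def L_def)
  moreover have "card (A \<inter> V - {s e1}) < card (A \<inter> V)"
    using e1 H ends fin by (intro card_Diff1_less) auto
  ultimately show False using eq by simp
qed

lemma degree_minus_perfect_matching:
  assumes "N \<subseteq> E" "bij_betw s N A" "bij_betw t N B"
  shows "a \<in> A \<Longrightarrow> card {e \<in> E - N. s e = a} = 2" "b \<in> B \<Longrightarrow> card {e \<in> E - N. t e = b} = 2"
proof -
  assume a: "a \<in> A"
  then have "a \<in> s ` N" using assms(2) by (simp add: bij_betw_def)
  then obtain d where d: "d \<in> N" "s d = a" by blast
  then have "{e \<in> E - N. s e = a} = {e\<in>E. s e = a} - {d}"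
    using assms(2) by (auto simp: bij_betw_def inj_on_def)
  then show "card {e \<in> E - N. s e = a} = 2"
    using d subsetD[OF assms(1) d(1)] deg_A[OF a] by simp
next
  assume b: "b \<in> B"
  then have "b \<in> t ` N" using assms(3) by (simp add: bij_betw_def)
  then obtain d where d: "d \<in> N" "t d = b" by blast
  then have "{e \<in> E - N. t e = b} = {e\<in>E. t e = b} - {d}"
    using assms(3) by (auto simp: bij_betw_def inj_on_def)
  then show "card {e \<in> E - N. t e = b} = 2"
    using d subsetD[OF assms(1) d(1)] deg_B[OF b] by simp
qed

text \<open>The condition on all closed sets \<open>V\<close> says that \<open>e1\<close> and
  \<open>e2\<close> lie in one component of \<open>E - N\<close>, with no reference to cycles
  yet.\<close>

lemma perfect_matching_joining:
  assumes e: "e1 \<in> E" "e2 \<in> E"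
  obtains N where "N \<subseteq> E - {e1, e2}" "bij_betw s N A" "bij_betw t N B"
    "\<And>V. (\<And>e. e \<in> E - N \<Longrightarrow> s e \<in> V \<longleftrightarrow> t e \<in> V) \<Longrightarrow> s e1 \<in> V \<Longrightarrow> s e2 \<in> V"
proof (cases "s e1 = s e2 \<or> t e1 = t e2")
  case True
  \<comment> \<open>At a shared end of degree 3 there is an edge \<open>d\<close> besides
    \<open>e1\<close> and \<open>e2\<close>. A perfect matching through \<open>d\<close> uses no
    other edge there, so it avoids both. This includes the case \<open>e1 = e2\<close>.\<close>
  have "\<exists>d\<in>E. d \<noteq> e1 \<and> d \<noteq> e2 \<and> (s d = s e1 \<and> s d = s e2 \<or> t d = t e1 \<and> t d = t e2)"
  proof -
    have third: "\<exists>d\<in>X. d \<noteq> e1 \<and> d \<noteq> e2" if "card X = 3" for X :: "'e set"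
    proof (rule ccontr)
      assume "\<not> ?thesis"
      then have "X \<subseteq> {e1, e2}" by blast
      then have "card X \<le> card {e1, e2}" by (intro card_mono) auto
      also have "\<dots> \<le> 2" by (simp add: card_insert_if)
      finally show False using that by simp
    qed
    show ?thesis
      using True third[OF deg_A[OF ends(1)[OF e(1)]]] third[OF deg_B[OF ends(2)[OF e(1)]]] by auto
  qed
  then obtain d where d: "d \<in> E" "d \<noteq> e1" "d \<noteq> e2"
      "s d = s e1 \<and> s d = s e2 \<or> t d = t e1 \<and> t d = t e2" by blast
  obtain N where N: "N \<subseteq> E" "d \<in> N" "bij_betw s N A" "bij_betw t N B"
    using perfect_matching_through[OF d(1)] by blast
  have notin: "e1 \<notin> N" "e2 \<notin> N" using N d by (auto simp: bij_betw_def inj_on_def)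
  show ?thesis
  proof (rule that[of N])
    fix V assume V: "\<And>e. e \<in> E - N \<Longrightarrow> s e \<in> V \<longleftrightarrow> t e \<in> V" "s e1 \<in> V"
    then have "s e1 \<in> V \<longleftrightarrow> t e1 \<in> V" "s e2 \<in> V \<longleftrightarrow> t e2 \<in> V" using notin e by blast+
    then show "s e2 \<in> V" using True V(2) by auto
  qed (use N notin in auto)
next
  case False
  then obtain M N where MN: "M \<subseteq> E" "bij_betw s M (A - {s e1})" "bij_betw t M (B - {t e2})"
    "N \<subseteq> E - M - {e1, e2}" "bij_betw s N A" "bij_betw t N B"
    using disjoint_matchings[OF e] by blast
  have N: "N \<subseteq> E" using MN by blast
  show ?thesis
  proof (rule that[of N])
    fix V assume V: "\<And>e. e \<in> E - N \<Longrightarrow> s e \<in> V \<longleftrightarrow> t e \<in> V" "s e1 \<in> V"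
    show "s e2 \<in> V"
      by (rule closed_component_contains[of M "E - N" e1 e2 V])
        (use MN V e degree_minus_perfect_matching[OF N MN(5,6)] in auto)
  qed (use MN in auto)
qed

end

section \<open>From the multigraph to its end maps, and from the matching back to a 2-factor\<close>

theorem theorem8:
  fixes G :: "('v, 'e) mgraph" and e1 e2 :: 'e
  assumes "multigraph G" and "mconnected G" and "mplanar G" and "mcubic G" and "mbipartite G"
    and "e1 \<in> medges G" and "e2 \<in> medges G"
  shows "\<exists>F C. two_factor F G \<and> mcycle C \<and> msubgraph C F \<and> e1 \<in> medges C \<and> e2 \<in> medges C"
proof -
  obtain A B where AB: "A \<union> B = mverts G" "A \<inter> B = {}"
    "\<forall>e\<in>medges G. \<exists>a\<in>A. \<exists>b\<in>B. mends G e = {a, b}"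
    using assms(5) by (auto simp: mbipartite_def)
  obtain s where s: "\<And>e. e \<in> medges G \<Longrightarrow> s e \<in> A \<and> (\<exists>b\<in>B. mends G e = {s e, b})"
    using AB(3) by metis
  obtain t where t: "\<And>e. e \<in> medges G \<Longrightarrow> t e \<in> B \<and> mends G e = {s e, t e}"
    using s by metis
  have fin: "finite (medges G)" "finite (mverts G)" using assms(1) by (auto simp: multigraph_def)
  have at_A: "a \<in> mends G e \<longleftrightarrow> s e = a" if "e \<in> medges G" "a \<in> A" for e a
    using s[OF that(1)] t[OF that(1)] AB(2) that(2) by auto
  have at_B: "b \<in> mends G e \<longleftrightarrow> t e = b" if "e \<in> medges G" "b \<in> B" for e b
    using s[OF that(1)] t[OF that(1)] AB(2) that(2) by auto
  have deg: "card {e \<in> medges G. v \<in> mends G e} = 3" if "v \<in> mverts G" for v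
    using assms(4) that by (simp add: mregular_def mdegree_def)
  interpret cubic_bipartite "medges G" s t A B
  proof
    show "finite A" "finite B" using AB(1) fin(2) by (metis finite_Un)+
    show "card {e \<in> medges G. s e = a} = 3" if "a \<in> A" for a
    proof -
      have "{e \<in> medges G. s e = a} = {e \<in> medges G. a \<in> mends G e}" using at_A that by auto
      then show ?thesis using deg AB(1) that by auto
    qed
    show "card {e \<in> medges G. t e = b} = 3" if "b \<in> B" for b
    proof -
      have "{e \<in> medges G. t e = b} = {e \<in> medges G. b \<in> mends G e}" using at_B that by auto
      then show ?thesis using deg AB(1) that by auto
    qed
    show "S = A" if S: "S \<subseteq> A" "T \<subseteq> B" "S \<noteq> {}" "\<And>e. e \<in> medges G \<Longrightarrow> s e \<in> S \<longleftrightarrow> t e \<in> T" for S T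
    proof
      obtain x where x: "x \<in> S" using S by blast
      show "A \<subseteq> S"
      proof
        fix y assume y: "y \<in> A"
        have "x \<in> mverts G" "y \<in> mverts G" using x y S(1) AB(1) by auto
        then have "(x, y) \<in> (madjacent G)\<^sup>*" using assms(2) by (simp add: mconnected_def)
        \<comment> \<open>Membership in \<open>S \<union> T\<close> propagates along a walk from
          \<open>x\<close>, since every edge has both ends in this set or neither.\<close>
        then have "y \<in> S \<union> T"
        proof (induction rule: rtrancl_induct)
          case base
          show ?case using x by simp
        next
          case (step u v)
          then obtain e where e: "e \<in> medges G" "mends G e = {u, v}" by (auto simp: madjacent_def)
          have "{u, v} = {s e, t e}" using e t by metis
          moreover have "s e \<in> A" "t e \<in> B" using s t e by auto
          ultimately show ?case using S(1,2) S(4)[OF e(1)] step.IH AB(2) by (auto simp: doubleton_eq_iff)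
        qed
        then show "y \<in> S" using y S AB(2) by blast
      qed
    qed (use S in auto)
  qed (use fin s t in simp_all)
  obtain N where N: "N \<subseteq> medges G - {e1, e2}" "bij_betw s N A" "bij_betw t N B"
    and join: "\<And>V. (\<And>e. e \<in> medges G - N \<Longrightarrow> s e \<in> V \<longleftrightarrow> t e \<in> V) \<Longrightarrow> s e1 \<in> V \<Longrightarrow> s e2 \<in> V"
    using perfect_matching_joining[OF assms(6,7)] by blast
  have N': "N \<subseteq> medges G" using N by blast
  define F where "F = \<lparr>mverts = mverts G, medges = medges G - N, mends = mends G\<rparr>"
  have F: "multigraph F" using assms(1) by (auto simp: F_def multigraph_def)
  have reg: "mregular 2 F"
    unfolding mregular_def mdegree_def
  proof
    fix v assume "v \<in> mverts F"
    then consider "v \<in> A" | "v \<in> B" using AB(1) by (auto simp: F_def)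
    then show "card {e \<in> medges F. v \<in> mends F e} = 2"
    proof cases
      case 1
      have "{e \<in> medges F. v \<in> mends F e} = {e \<in> medges G - N. s e = v}"
        using at_A 1 by (auto simp: F_def)
      then show ?thesis using degree_minus_perfect_matching(1)[OF N' N(2,3) 1] by simp
    next
      case 2
      have "{e \<in> medges F. v \<in> mends F e} = {e \<in> medges G - N. t e = v}"
        using at_B 2 by (auto simp: F_def)
      then show ?thesis using degree_minus_perfect_matching(2)[OF N' N(2,3) 2] by simp
    qed
  qed
  have two: "two_factor F G" using F reg by (auto simp: two_factor_def msubgraph_def F_def)
  have "e1 \<in> medges F" "e2 \<in> medges F" using N assms by (auto simp: F_def)
  then obtain C where C: "mcycle C" "msubgraph C F" "e1 \<in> medges C"
    and closed: "\<And>d. d \<in> medges F \<Longrightarrow> mends F d \<inter> mverts C \<noteq> {} \<Longrightarrow> d \<in> medges C"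
    using two_regular_cycle[OF F reg] by metis
  have ends_F: "mends F e = {s e, t e}" if "e \<in> medges F" for e using that t by (simp add: F_def)
  have ends_C: "{s e, t e} \<subseteq> mverts C" if "e \<in> medges C" for e
  proof -
    have "e \<in> medges F" "mends C e = mends F e" using C(2) that unfolding msubgraph_def by blast+
    moreover have "mends C e \<subseteq> mverts C"
      using C(2) that unfolding msubgraph_def multigraph_def by blast
    ultimately show ?thesis using ends_F by simp
  qed
  \<comment> \<open>The vertex set of \<open>C\<close> serves as the closed set: an edge of
    \<open>F\<close> that touches it belongs to \<open>C\<close> and so has both ends there.\<close>
  have "s e2 \<in> mverts C"
  proof (rule join)
    fix e assume "e \<in> medges G - N"
    then have "e \<in> medges F" by (simp add: F_def)
    then show "s e \<in> mverts C \<longleftrightarrow> t e \<in> mverts C"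
      using closed[of e] ends_F[of e] ends_C[of e] by blast
  qed (use ends_C[OF C(3)] in simp)
  then have "e2 \<in> medges C" using closed[of e2] ends_F[of e2] \<open>e2 \<in> medges F\<close> by blast
  then show ?thesis using two C by blast
qed

end
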